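(* Let $W \in \mathbb{C}[x_1,\dots,x_n]$ be an admissible polynomial with $m \times n$ exponent matrix $A$, and let the $A_i$ denote the invertible submatrices of $A$, up to equivalence. Then $$G_W^{\max} = \bigcap_{A_i} \langle \text{columns of } A_i^{-1} \rangle,$$ where $\langle \text{columns of } A_i^{-1}\rangle$ denotes the subgroup of $(\mathbb{Q}/\mathbb{Z})^n$ generated by the classes modulo $\mathbb{Z}^n$ of the columns of $A_i^{-1}$.
   Context: A polynomial $W \in \mathbb{C}[x_1,\dots,x_n]$ is nondegenerate if it has an isolated critical point at the origin. It is quasihomogeneous if there are positive rational numbers $q_1,\dots,q_n$ (the weights) with $W(c^{q_1}x_1,\dots,c^{q_n}x_n) = cW(x_1,\dots,x_n)$ for all $c\in\mathbb{C}$; equivalently, every monomial $x_1^{a_1}\cdots x_n^{a_n}$ of $W$ satisfies $\sum_j a_j q_j = 1$. $W$ is admissible if it is nondegenerate, quasihomogeneous with unique weights, and has no monomials of the form $x_i x_j$ with $i \neq j$. Writing $W = \sum_{i=1}^m c_i \prod_{j=1}^n x_j^{a_{ij}}$ as a sum of its $m$ distinct monomials (with $c_i \ne 0$), the exponent matrix of $W$ is the $m\times n$ matrix $A = (a_{ij})$. For admissible $W$ one has $m \ge n$ and $A$ has rank $n$. The maximal (diagonal) symmetry group of $W$ is $\{(\zeta_1,\dots,\zeta_n)\in(\mathbb{C}^\times)^n \mid W(\zeta_1x_1,\dots,\zeta_nx_n) = W(x_1,\dots,x_n)\}$; all coordinates of its elements are roots of unity, and in additive notation (via $(e^{2\pi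 i\theta_1},\dots,e^{2\pi i\theta_n}) \mapsto (\theta_1,\dots,\theta_n) \bmod \mathbb{Z}$) it is written $$G_W^{\max} = \{\mathbf{g} \in (\mathbb{Q}/\mathbb{Z})^n \mid A\mathbf{g} \in \mathbb{Z}^m\},$$ where the condition $A\mathbf{g}\in\mathbb{Z}^m$ is independent of the representative of $\mathbf g$ in $\mathbb{Q}^n$. A submatrix of $A$ means an $n\times n$ matrix consisting of $n$ of the rows of $A$. Two submatrices are equivalent if they differ only by a permutation of rows. Invertible means invertible over $\mathbb{Q}$. *)

theory Defs
  imports
    "HOL-Analysis.Analysis"
    "HOL-Library.Poly_Mapping"
    "HOL-Computational_Algebra.Group_Closure"
begin

subsection \<open>Polynomials in finitely many variables\<close>

text \<open>The variables are indexed by a finite type, so that \<open>n\<close> is the cardinality of \<^typ>\<open>'n\<close>.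
  A polynomial maps exponent vectors to coefficients; \<^const>\<open>Poly_Mapping.keys\<close> is the set of its
  monomials.\<close>

type_synonym ('n, 'a) mpoly = "('n \<Rightarrow>\<^sub>0 nat) \<Rightarrow>\<^sub>0 'a"

definition mono_eval :: "('n::finite \<Rightarrow>\<^sub>0 nat) \<Rightarrow> complex ^ 'n \<Rightarrow> complex" where
  "mono_eval a x = (\<Prod>j\<in>UNIV. (x $ j) ^ Poly_Mapping.lookup a j)"

definition mpoly_eval :: "('n::finite, complex) mpoly \<Rightarrow> complex ^ 'n \<Rightarrow> complex" where
  "mpoly_eval W x = (\<Sum>a\<in>Poly_Mapping.keys W. Poly_Mapping.lookup W a * mono_eval a x)"

subsection \<open>Admissible polynomials\<close>

definition critical_points :: "('n::finite, complex) mpoly \<Rightarrow> (complex ^ 'n) set" where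
  "critical_points W = {z. (mpoly_eval W has_derivative (\<lambda>_. 0)) (at z)}"

definition nondegenerate :: "('n::finite, complex) mpoly \<Rightarrow> bool" where
  "nondegenerate W \<longleftrightarrow> 0 isolated_in critical_points W"

text \<open>Here \<open>c\<^bsup>q\<^esup>\<close> is read with the principal branch. The choice is
  immaterial, by \<open>is_weight_system_iff\<close> below.\<close>

definition is_weight_system :: "('n::finite, complex) mpoly \<Rightarrow> rat ^ 'n \<Rightarrow> bool" where
  "is_weight_system W q \<longleftrightarrow> (\<forall>j. q $ j > 0) \<and>
     (\<forall>c x. mpoly_eval W (\<chi> j. c powr of_rat (q $ j) * x $ j) = c * mpoly_eval W x)"

definition admissible :: "('n::finite, complex) mpoly \<Rightarrow> bool" where
  "admissible W \<longleftrightarrow> nondegenerate W \<and> (\<exists>!q. is_weight_system W q) \<and>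
     (\<forall>i j. i \<noteq> j \<longrightarrow> Poly_Mapping.single i 1 + Poly_Mapping.single j 1 \<notin> Poly_Mapping.keys W)"

subsection \<open>Exponent matrices and their submatrices\<close>

text \<open>The exponent matrix depends on an enumeration \<open>e\<close> of the monomials, by a finite index type
  \<^typ>\<open>'m\<close> whose cardinality is the number \<open>m\<close> of monomials. It is taken over \<^typ>\<open>rat\<close>, where
  invertibility is meant.\<close>

definition is_exponent_matrix :: "('n::finite, complex) mpoly \<Rightarrow> rat ^ 'n ^ 'm \<Rightarrow> bool" where
  "is_exponent_matrix W A \<longleftrightarrow>
     (\<exists>e. bij_betw e UNIV (Poly_Mapping.keys W) \<and> (\<forall>i j. A $ i $ j = of_nat (Poly_Mapping.lookup (e i) j)))"

definition invertible_submatrices :: "rat ^ 'n ^ 'm \<Rightarrow> (rat ^ 'n ^ 'n) set" where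
  "invertible_submatrices A = {B. invertible B \<and> (\<exists>f. inj f \<and> B = (\<chi> i. A $ f i))}"

definition row_equivalent :: "'a ^ 'n ^ 'k \<Rightarrow> 'a ^ 'n ^ 'k \<Rightarrow> bool" where
  "row_equivalent B C \<longleftrightarrow> (\<exists>p. bij p \<and> C = (\<chi> i. B $ p i))"

text \<open>A choice of one matrix from each class of invertible submatrices up to row permutation.\<close>

definition is_representative_system :: "(rat ^ 'n ^ 'n) set \<Rightarrow> rat ^ 'n ^ 'm \<Rightarrow> bool" where
  "is_representative_system R A \<longleftrightarrow> R \<subseteq> invertible_submatrices A \<and>
     (\<forall>B\<in>invertible_submatrices A. \<exists>!C. C \<in> R \<and> row_equivalent B C)"

subsection \<open>The group \<open>\<rat>/\<int>\<close> and the maximal symmetry group\<close>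

quotient_type rat_mod_int = rat / "\<lambda>x y. x - y \<in> \<int>"
  morphisms rep_rat_mod_int rat_mod_int_of
proof (rule equivpI)
  show "reflp (\<lambda>x y :: rat. x - y \<in> \<int>)"
    by (simp add: reflp_def)
  show "symp (\<lambda>x y :: rat. x - y \<in> \<int>)"
  proof (rule sympI)
    fix x y :: rat
    assume "x - y \<in> \<int>"
    then have "- (x - y) \<in> \<int>" by (rule Ints_minus)
    then show "y - x \<in> \<int>" by simp
  qed
  show "transp (\<lambda>x y :: rat. x - y \<in> \<int>)"
  proof (rule transpI)
    fix x y z :: rat
    assume "x - y \<in> \<int>" "y - z \<in> \<int>"
    then have "(x - y) + (y - z) \<in> \<int>" by (rule Ints_add)
    then show "x - z \<in> \<int>" by simp
  qed
qed

instantiation rat_mod_int :: ab_group_add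
begin

lift_definition zero_rat_mod_int :: rat_mod_int is 0 .

lift_definition plus_rat_mod_int :: "rat_mod_int \<Rightarrow> rat_mod_int \<Rightarrow> rat_mod_int" is "(+)"
proof -
  fix x x' y y' :: rat
  assume "x - x' \<in> \<int>" "y - y' \<in> \<int>"
  then have "(x - x') + (y - y') \<in> \<int>" by (rule Ints_add)
  then show "(x + y) - (x' + y') \<in> \<int>" by (simp add: algebra_simps)
qed

lift_definition uminus_rat_mod_int :: "rat_mod_int \<Rightarrow> rat_mod_int" is uminus
proof -
  fix x x' :: rat
  assume "x - x' \<in> \<int>"
  then have "- (x - x') \<in> \<int>" by (rule Ints_minus)
  then show "- x - - x' \<in> \<int>" by simp
qed

lift_definition minus_rat_mod_int :: "rat_mod_int \<Rightarrow> rat_mod_int \<Rightarrow> rat_mod_int" is "(-)"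
proof -
  fix x x' y y' :: rat
  assume "x - x' \<in> \<int>" "y - y' \<in> \<int>"
  then have "(x - x') - (y - y') \<in> \<int>" by (rule Ints_diff)
  then show "(x - y) - (x' - y') \<in> \<int>" by (simp add: algebra_simps)
qed

instance
  by standard (transfer; simp add: algebra_simps)+

end

definition vec_mod_int :: "rat ^ 'n \<Rightarrow> rat_mod_int ^ 'n" where
  "vec_mod_int v = (\<chi> j. rat_mod_int_of (v $ j))"

text \<open>The group in additive notation. Neither the representative nor the additive form matters, by
  \<open>vec_mod_int_in_max_symmetry_group_iff\<close> and
  \<open>vec_mod_int_in_max_symmetry_group_iff_diagonal\<close> below.\<close>

definition max_symmetry_group :: "rat ^ 'n ^ 'm \<Rightarrow> (rat_mod_int ^ 'n) set" where
  "max_symmetry_group A = {g. \<exists>v. vec_mod_int v = g \<and> (\<forall>i. (A *v v) $ i \<in> \<int>)}"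

definition diagonal_symmetries :: "('n::finite, complex) mpoly \<Rightarrow> (complex ^ 'n) set" where
  "diagonal_symmetries W =
     {z. (\<forall>j. z $ j \<noteq> 0) \<and> (\<forall>x. mpoly_eval W (\<chi> j. z $ j * x $ j) = mpoly_eval W x)}"

subsection \<open>Agreement with the other descriptions of these notions\<close>

lemma mono_eval_mult: "mono_eval a (\<chi> j. x $ j * y $ j) = mono_eval a x * mono_eval a y"
  by (simp add: mono_eval_def power_mult_distrib prod.distrib)

lemma mono_eval_separates:
  assumes "a \<noteq> b"
  obtains y :: "complex ^ 'n" where "mono_eval a y \<noteq> mono_eval (b :: 'n::finite \<Rightarrow>\<^sub>0 nat) y"
proof -
  from assms obtain k where k: "Poly_Mapping.lookup a k \<noteq> Poly_Mapping.lookup b k"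
    by (meson poly_mapping_eqI)
  define y :: "complex ^ 'n" where "y = (\<chi> j. if j = k then 2 else 1)"
  have y: "mono_eval d y = 2 ^ Poly_Mapping.lookup d k" for d
  proof -
    have "mono_eval d y = (\<Prod>j\<in>UNIV. if j = k then 2 ^ Poly_Mapping.lookup d j else 1)"
      unfolding mono_eval_def y_def by (intro prod.cong) auto
    then show ?thesis by simp
  qed
  have "(2 :: complex) ^ Poly_Mapping.lookup a k \<noteq> 2 ^ Poly_Mapping.lookup b k"
  proof
    assume "(2 :: complex) ^ Poly_Mapping.lookup a k = 2 ^ Poly_Mapping.lookup b k"
    then have "norm ((2 :: complex) ^ Poly_Mapping.lookup a k) = norm ((2 :: complex) ^ Poly_Mapping.lookup b k)"
      by simp
    then have "(2 :: real) ^ Poly_Mapping.lookup a k = 2 ^ Poly_Mapping.lookup b k"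
      by (simp add: norm_power)
    with k show False by simp
  qed
  with y that show thesis by metis
qed

lemma mono_eval_independent:
  fixes S :: "('n::finite \<Rightarrow>\<^sub>0 nat) set"
  assumes "finite S" "\<And>x. (\<Sum>a\<in>S. c a * mono_eval a x) = 0" "a \<in> S"
  shows "c a = 0"
  using assms
proof (induction S arbitrary: c a rule: finite_induct)
  case empty
  then show ?case by simp
next
  case (insert b S)
  have S0: "c d = 0" if d: "d \<in> S" for d
  proof -
    from d insert.hyps have "d \<noteq> b" by auto
    then obtain y where y: "mono_eval d y \<noteq> mono_eval b y" by (rule mono_eval_separates)
    have "(\<Sum>a\<in>S. (c a * (mono_eval a y - mono_eval b y)) * mono_eval a x) = 0" for x
    proof -
      have "(\<Sum>a\<in>insert b S. c a * mono_eval a (\<chi> j. y $ j * x $ j))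
          - mono_eval b y * (\<Sum>a\<in>insert b S. c a * mono_eval a x) = 0"
        by (simp only: insert.prems(1)) simp
      then show ?thesis
        using insert.hyps
        by (simp add: mono_eval_mult sum_distrib_left sum_subtractf algebra_simps)
    qed
    from insert.IH[OF this d] y show ?thesis by simp
  qed
  have "c b = 0"
  proof -
    have "(\<Sum>a\<in>S. c a * mono_eval a 1) = 0"
      using S0 by (intro sum.neutral) simp
    with insert.prems(1)[of 1] insert.hyps have "c b * mono_eval b 1 = 0" by simp
    then show ?thesis by (simp add: mono_eval_def)
  qed
  with S0 insert.prems(2) show ?case by auto
qed

lemma mpoly_eval_scale_iff:
  "(\<forall>x. mpoly_eval W (\<chi> j. z $ j * x $ j) = c * mpoly_eval W x) \<longleftrightarrow>
   (\<forall>a\<in>Poly_Mapping.keys W. mono_eval a z = c)"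
proof
  assume eq: "\<forall>x. mpoly_eval W (\<chi> j. z $ j * x $ j) = c * mpoly_eval W x"
  have "(\<Sum>a\<in>Poly_Mapping.keys W. (Poly_Mapping.lookup W a * (mono_eval a z - c)) * mono_eval a x) = 0" for x
    using eq[rule_format, of x]
    by (simp add: mpoly_eval_def mono_eval_mult sum_distrib_left sum_subtractf algebra_simps)
  from mono_eval_independent[OF finite_keys this]
  show "\<forall>a\<in>Poly_Mapping.keys W. mono_eval a z = c" by (auto simp: in_keys_iff)
next
  assume "\<forall>a\<in>Poly_Mapping.keys W. mono_eval a z = c"
  then show "\<forall>x. mpoly_eval W (\<chi> j. z $ j * x $ j) = c * mpoly_eval W x"
    by (auto simp: mpoly_eval_def mono_eval_mult sum_distrib_left intro!: sum.cong)
qed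

lemma mono_eval_exp:
  "mono_eval a (\<chi> j. exp (t * of_rat (v $ j))) = exp (t * of_rat (\<Sum>j\<in>UNIV. of_nat (Poly_Mapping.lookup a j) * v $ j))"
  by (simp add: mono_eval_def exp_of_nat_mult[symmetric] exp_sum[symmetric] of_rat_sum
      of_rat_mult sum_distrib_left algebra_simps)

lemma complex_of_real_of_rat: "complex_of_real (of_rat s) = of_rat s"
  by (cases s) (simp add: of_rat_rat)

lemma is_weight_system_iff:
  "is_weight_system W q \<longleftrightarrow> (\<forall>j. q $ j > 0) \<and>
     (\<forall>a\<in>Poly_Mapping.keys W. (\<Sum>j\<in>UNIV. of_nat (Poly_Mapping.lookup a j) * q $ j) = 1)"
proof -
  let ?s = "\<lambda>a. \<Sum>j\<in>UNIV. of_nat (Poly_Mapping.lookup a j) * q $ j"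
  have nz: "mono_eval a (\<chi> j. c powr of_rat (q $ j)) = exp (Ln c * of_rat (?s a))"
    if "c \<noteq> 0" for a c
    using that mono_eval_exp[of a "Ln c" q] by (simp add: powr_def mult.commute)
  have "is_weight_system W q \<longleftrightarrow> (\<forall>j. q $ j > 0) \<and>
      (\<forall>c. \<forall>a\<in>Poly_Mapping.keys W. mono_eval a (\<chi> j. c powr of_rat (q $ j)) = c)"
    unfolding is_weight_system_def
    using mpoly_eval_scale_iff[of W "\<chi> j. _ powr of_rat (q $ j)"] by simp
  also have "\<dots> \<longleftrightarrow> (\<forall>j. q $ j > 0) \<and> (\<forall>a\<in>Poly_Mapping.keys W. ?s a = 1)"
  proof (intro conj_cong refl iffI ballI allI)
    fix a
    assume "\<forall>c. \<forall>a\<in>Poly_Mapping.keys W. mono_eval a (\<chi> j. c powr of_rat (q $ j)) = c" "a \<in> Poly_Mapping.keys W"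
    then have "mono_eval a (\<chi> j. exp 1 powr of_rat (q $ j)) = exp 1" by blast
    then have "exp (of_rat (?s a) :: complex) = exp 1" by (subst (asm) nz) simp_all
    then have "exp (complex_of_real (of_rat (?s a))) = exp (complex_of_real 1)"
      by (simp add: complex_of_real_of_rat)
    then have "complex_of_real (exp (of_rat (?s a))) = complex_of_real (exp 1)"
      by (simp only: exp_of_real)
    then have "exp (of_rat (?s a) :: real) = exp 1" by (simp only: of_real_eq_iff)
    then have "(of_rat (?s a) :: real) = of_rat 1" by simp
    then show "?s a = 1" by (simp only: of_rat_eq_iff)
  next
    fix c :: complex and a
    assume pos: "\<forall>j. q $ j > 0" and s: "\<forall>a\<in>Poly_Mapping.keys W. ?s a = 1" and a: "a \<in> Poly_Mapping.keys W"
    show "mono_eval a (\<chi> j. c powr of_rat (q $ j)) = c"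
    proof (cases "c = 0")
      case False
      with nz s a show ?thesis by simp
    next
      case True
      have "\<exists>j. Poly_Mapping.lookup a j \<noteq> 0"
      proof (rule ccontr)
        assume "\<not> ?thesis"
        then have "?s a = 0" by simp
        with s a show False by simp
      qed
      with True show ?thesis by (auto simp: mono_eval_def zero_power)
    qed
  qed
  finally show ?thesis .
qed

lemma exp_2pi_rat_eq_1_iff: "exp (2 * of_real pi * \<i> * of_rat s) = 1 \<longleftrightarrow> s \<in> \<int>"
proof -
  have "exp (2 * of_real pi * \<i> * of_rat s) = 1 \<longleftrightarrow>
      exp (2 * of_real pi * \<i> * complex_of_real (of_rat s)) = 1"
    by (simp only: complex_of_real_of_rat)
  also have "\<dots> \<longleftrightarrow> (\<exists>k::int. (of_rat s :: real) = of_int k)"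
    by (simp add: exp_eq_1 mult.commute mult.left_commute)
  also have "\<dots> \<longleftrightarrow> s \<in> \<int>"
    by (metis Ints_cases Ints_of_int of_rat_eq_iff of_rat_of_int_eq)
  finally show ?thesis .
qed

lemma vec_mod_int_in_max_symmetry_group_iff:
  fixes A :: "rat ^ 'n::finite ^ 'm"
  assumes "is_exponent_matrix W A"
  shows "vec_mod_int v \<in> max_symmetry_group A \<longleftrightarrow> (\<forall>i. (A *v v) $ i \<in> \<int>)"
proof
  assume "vec_mod_int v \<in> max_symmetry_group A"
  then obtain u where u: "vec_mod_int u = vec_mod_int v" and int: "\<And>i. (A *v u) $ i \<in> \<int>"
    by (auto simp: max_symmetry_group_def)
  from u have d: "v $ j - u $ j \<in> \<int>" for j
    by (metis (no_types, lifting) Ints_minus minus_diff_eq rat_mod_int.abs_eq_iff vec_lambda_beta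
        vec_mod_int_def)
  have A: "A $ i $ j \<in> \<int>" for i j
    using assms by (auto simp: is_exponent_matrix_def)
  have "(A *v (v - u)) $ i \<in> \<int>" for i
    unfolding matrix_vector_mult_def using d A by (auto intro!: Ints_sum Ints_mult)
  with int have "(A *v u) $ i + (A *v (v - u)) $ i \<in> \<int>" for i by (intro Ints_add)
  then show "\<forall>i. (A *v v) $ i \<in> \<int>" by (simp add: matrix_vector_mult_diff_distrib)
qed (auto simp: max_symmetry_group_def)

lemma vec_mod_int_in_max_symmetry_group_iff_diagonal:
  fixes A :: "rat ^ 'n::finite ^ 'm"
  assumes "is_exponent_matrix W A"
  shows "vec_mod_int v \<in> max_symmetry_group A \<longleftrightarrow>
         (\<chi> j. exp (2 * of_real pi * \<i> * of_rat (v $ j))) \<in> diagonal_symmetries W"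
proof -
  from assms obtain e where e: "bij_betw e UNIV (Poly_Mapping.keys W)"
    and A: "\<And>i j. A $ i $ j = of_nat (Poly_Mapping.lookup (e i) j)"
    by (auto simp: is_exponent_matrix_def)
  let ?z = "\<chi> j. exp (2 * of_real pi * \<i> * of_rat (v $ j))"
  have "?z \<in> diagonal_symmetries W \<longleftrightarrow> (\<forall>a\<in>Poly_Mapping.keys W. mono_eval a ?z = 1)"
    using mpoly_eval_scale_iff[of W ?z 1] by (simp add: diagonal_symmetries_def)
  also have "\<dots> \<longleftrightarrow> (\<forall>i. mono_eval (e i) ?z = 1)"
    using e by (metis UNIV_I bij_betwE bij_betw_imp_surj_on imageE)
  also have "\<dots> \<longleftrightarrow> (\<forall>i. (A *v v) $ i \<in> \<int>)"
    by (simp only: mono_eval_exp exp_2pi_rat_eq_1_iff) (simp add: matrix_vector_mult_def A)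
  finally show ?thesis using vec_mod_int_in_max_symmetry_group_iff[OF assms] by simp
qed

end

theory Submission
  imports Defs
begin

text \<open>A vector represents an element of the subgroup generated by the columns of \<open>B\<^sup>-\<^sup>1\<close> iff \<open>B\<close> maps
  it to an integral vector. This settles one inclusion. For the other one, uniqueness of the
  weights makes \<open>A\<close> injective: a kernel vector could be added to the weights after scaling it down
  to keep them positive. So the rows of \<open>A\<close> span, and every nonzero row can be extended to a basis
  consisting of rows. Every condition of \<open>A v \<in> \<int>\<^sup>m\<close> is therefore one of the conditions of
  \<open>B v \<in> \<int>\<^sup>n\<close> for some invertible submatrix \<open>B\<close>.\<close>

lemma vec_mod_int_0: "vec_mod_int 0 = 0"
  by (simp add: vec_mod_int_def vec_eq_iff zero_rat_mod_int_def)

lemma vec_mod_int_diff: "vec_mod_int (u - v) = vec_mod_int u - vec_mod_int v"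
  by (simp add: vec_mod_int_def vec_eq_iff minus_rat_mod_int.abs_eq)

lemma vec_mod_int_eq_iff: "vec_mod_int u = vec_mod_int v \<longleftrightarrow> (\<forall>j. u $ j - v $ j \<in> \<int>)"
  by (simp add: vec_mod_int_def vec_eq_iff rat_mod_int.abs_eq_iff)

lemma surj_vec_mod_int: "surj vec_mod_int"
proof (rule surjI)
  fix g :: "rat_mod_int ^ 'a"
  show "vec_mod_int (\<chi> j. rep_rat_mod_int (g $ j)) = g"
    using Quotient3_abs_rep[OF Quotient3_rat_mod_int]
    by (simp add: vec_mod_int_def vec_eq_iff)
qed

lemma matrix_vector_mult_Ints:
  fixes A :: "rat ^ 'n::finite ^ 'm"
  assumes "\<And>i j. A $ i $ j \<in> \<int>" "\<And>j. v $ j \<in> \<int>"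
  shows "(A *v v) $ i \<in> \<int>"
  using assms by (auto simp: matrix_vector_mult_def intro!: Ints_sum Ints_mult)

lemma matrix_inv_mult:
  fixes B :: "'a::field ^ 'n ^ 'n"
  assumes "invertible B"
  shows "B ** matrix_inv B = mat 1" "matrix_inv B ** B = mat 1"
  using someI_ex[OF assms[unfolded invertible_def]] by (simp_all add: matrix_inv_def)

lemma group_closure_sum:
  assumes "\<And>i. i \<in> I \<Longrightarrow> f i \<in> group_closure S"
  shows "sum f I \<in> group_closure S"
  using assms by (induction I rule: infinite_finite_induct) (auto intro: group_closure_add)

lemma vec_mod_int_scale_in_group_closure:
  assumes "vec_mod_int v \<in> group_closure S" "k \<in> \<int>"
  shows "vec_mod_int (k *s v) \<in> group_closure S"
proof -
  from assms(2) obtain z where "k = of_int z" by (elim Ints_cases)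
  moreover have "vec_mod_int (of_int z *s v) \<in> group_closure S"
  proof (induction z rule: int_induct[of _ 0])
    case base
    show ?case by (simp add: vec_mod_int_0)
  next
    case (step1 z)
    \<comment> \<open>Adding \<open>v\<close> is written as subtracting its negative, so that
      compatibility of \<open>vec_mod_int\<close> with differences suffices.\<close>
    have "vec_mod_int (of_int (z + 1) *s v) = vec_mod_int (of_int z *s v) - (0 - vec_mod_int v)"
      by (simp add: vec_mod_int_diff[symmetric] vec_mod_int_0[symmetric] vector_sadd_rdistrib)
    with step1 assms(1) show ?case by (simp add: group_closure_add)
  next
    case (step2 z)
    have "vec_mod_int (of_int (z - 1) *s v) = vec_mod_int (of_int z *s v) - vec_mod_int v"
      by (simp add: vec_mod_int_diff[symmetric] vec.scale_left_diff_distrib)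
    with step2 assms(1) show ?case by (simp add: group_closure.diff)
  qed
  ultimately show ?thesis by simp
qed

lemma vec_mod_int_sum: "vec_mod_int (sum f I) = (\<Sum>i\<in>I. vec_mod_int (f i))"
proof -
  have "vec_mod_int (u + v) = vec_mod_int u + vec_mod_int v" for u v :: "rat ^ 'a"
    by (simp add: vec_mod_int_def vec_eq_iff plus_rat_mod_int.abs_eq)
  then show ?thesis
    by (induction I rule: infinite_finite_induct) (simp_all add: vec_mod_int_0)
qed

text \<open>\<open>B\<close> sends the columns of its inverse to the unit vectors, and integrality
  of the image survives differences. Conversely, the entries of \<open>B *v v\<close> are the
  coefficients of \<open>v\<close> in terms of these columns.\<close>

lemma vec_mod_int_in_group_closure_columns_inv_iff:
  fixes B :: "rat ^ 'n::finite ^ 'n"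
  assumes inv: "invertible B" and int: "\<And>i j. B $ i $ j \<in> \<int>"
  shows "vec_mod_int v \<in> group_closure (vec_mod_int ` columns (matrix_inv B)) \<longleftrightarrow>
         (\<forall>i. (B *v v) $ i \<in> \<int>)"
    (is "_ \<in> ?G \<longleftrightarrow> _")
proof
  \<comment> \<open>The induction runs over classes, so it can only provide some representative with
    integral image.\<close>
  have "\<exists>u. g = vec_mod_int u \<and> (\<forall>i. (B *v u) $ i \<in> \<int>)" if "g \<in> ?G" for g
    using that
  proof induction
    case (base g)
    \<comment> \<open>The base case of \<open>group_closure\<close> admits 0 besides the
      generators.\<close>
    then consider "g = 0" | j where "g = vec_mod_int (column j (matrix_inv B))"
      by (auto simp: columns_def)
    then show ?case
    proof cases
      case 1
      then show ?thesis by (intro exI[of _ 0]) (simp add: vec_mod_int_0)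
    next
      case (2 j)
      have "B *v column j (matrix_inv B) = column j (B ** matrix_inv B)"
        by (simp add: column_def matrix_vector_mult_def matrix_matrix_mult_def vec_eq_iff)
      then have "(B *v column j (matrix_inv B)) $ i \<in> \<int>" for i
        by (simp add: matrix_inv_mult[OF inv] column_def mat_def)
      with 2 show ?thesis by blast
    qed
  next
    case (diff g h)
    then obtain u w where "g = vec_mod_int u" "h = vec_mod_int w"
      and "\<And>i. (B *v u) $ i \<in> \<int>" "\<And>i. (B *v w) $ i \<in> \<int>"
      by blast
    then show ?case
      by (intro exI[of _ "u - w"]) (simp add: vec_mod_int_diff matrix_vector_mult_diff_distrib)
  qed
  moreover assume "vec_mod_int v \<in> ?G"
  ultimately obtain u where u: "vec_mod_int v = vec_mod_int u" "\<And>i. (B *v u) $ i \<in> \<int>"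
    by blast
  \<comment> \<open>The representatives \<open>u\<close> and \<open>v\<close> differ by an integral
    vector, which the integral matrix \<open>B\<close> keeps integral.\<close>
  then have "(B *v (v - u)) $ i \<in> \<int>" for i
    using int by (intro matrix_vector_mult_Ints) (simp_all add: vec_mod_int_eq_iff)
  then have "(B *v (v - u)) $ i + (B *v u) $ i \<in> \<int>" for i
    using u(2) by (rule Ints_add)
  then show "\<forall>i. (B *v v) $ i \<in> \<int>"
    by (simp add: matrix_vector_mult_diff_distrib)
next
  assume v: "\<forall>i. (B *v v) $ i \<in> \<int>"
  have "v = matrix_inv B *v (B *v v)"
    by (simp add: matrix_vector_mul_assoc matrix_inv_mult[OF inv])
  also have "\<dots> = (\<Sum>j\<in>UNIV. (B *v v) $ j *s column j (matrix_inv B))"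
    by (simp add: matrix_mult_sum)
  finally have "vec_mod_int v = (\<Sum>j\<in>UNIV. vec_mod_int ((B *v v) $ j *s column j (matrix_inv B)))"
    using vec_mod_int_sum by metis
  also have "\<dots> \<in> ?G"
    using v by (intro group_closure_sum vec_mod_int_scale_in_group_closure)
      (auto simp: columns_def intro!: group_closure.base)
  finally show "vec_mod_int v \<in> ?G" .
qed

lemma positive_perturbation:
  fixes q w :: "'a::linordered_field ^ 'n::finite"
  assumes "\<And>j. q $ j > 0"
  obtains d where "d > 0" "\<And>j. (q + d *s w) $ j > 0"
proof
  \<comment> \<open>The summand 1 keeps the denominators positive and leaves a margin:
    \<open>d * \<bar>w $ j\<bar>\<close> is at most \<open>q $ j - d\<close>, hence less than
    \<open>q $ j\<close>.\<close>
  define d where "d = Min (range (\<lambda>j. q $ j / (\<bar>w $ j\<bar> + 1)))"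
  have pos: "\<bar>x\<bar> + 1 > 0" for x :: 'a
    by (simp add: add_nonneg_pos)
  then show "d > 0"
    using assms by (simp add: d_def)
  fix j
  have "d \<le> q $ j / (\<bar>w $ j\<bar> + 1)"
    by (simp add: d_def)
  then have "d * (\<bar>w $ j\<bar> + 1) \<le> q $ j"
    using pos[of "w $ j"] by (simp add: pos_le_divide_eq)
  moreover have "d * (- w $ j) \<le> d * \<bar>w $ j\<bar>"
    using \<open>d > 0\<close> by (intro mult_left_mono) auto
  ultimately show "(q + d *s w) $ j > 0"
    using \<open>d > 0\<close> by (simp add: algebra_simps)
qed

lemma unique_weights_imp_kernel_trivial:
  fixes W :: "('n::finite, complex) mpoly" and A :: "rat ^ 'n ^ 'm::finite"
  assumes unique: "\<exists>!q. is_weight_system W q" and A: "is_exponent_matrix W A" and w: "A *v w = 0"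
  shows "w = 0"
proof -
  obtain e where e: "bij_betw e UNIV (Poly_Mapping.keys W)"
    and Ae: "\<And>i j. A $ i $ j = of_nat (Poly_Mapping.lookup (e i) j)"
    using A by (auto simp: is_exponent_matrix_def)
  \<comment> \<open>Here \<open>1\<close> is the all-ones vector: weight systems are the positive
    solutions of a linear system, which a kernel vector can perturb.\<close>
  have weights: "is_weight_system W q \<longleftrightarrow> (\<forall>j. q $ j > 0) \<and> A *v q = 1" for q
  proof -
    have "(\<forall>a\<in>Poly_Mapping.keys W. (\<Sum>j\<in>UNIV. of_nat (Poly_Mapping.lookup a j) * q $ j) = 1) \<longleftrightarrow>
          A *v q = 1"
      by (simp add: bij_betw_imp_surj_on[OF e, symmetric] vec_eq_iff matrix_vector_mult_def Ae)
    then show ?thesis by (simp add: is_weight_system_iff)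
  qed
  obtain q where q: "is_weight_system W q"
    using unique by blast
  then obtain d where d: "d > 0" "\<And>j. (q + d *s w) $ j > 0"
    using positive_perturbation[of q w] weights by metis
  have "A *v (q + d *s w) = 1"
    using q w by (simp add: weights matrix_vector_right_distrib vec.scale)
  with d have "is_weight_system W (q + d *s w)"
    by (simp add: weights)
  with q unique have "q + d *s w = q" by blast
  with d(1) show ?thesis by simp
qed

text \<open>A trivial kernel makes the rows span, so a nonzero row, being independent by itself,
  extends within the set of rows to a basis.\<close>

lemma nonzero_row_in_invertible_submatrix:
  fixes A :: "rat ^ 'n::finite ^ 'm::finite"
  assumes ker: "\<And>w. A *v w = 0 \<Longrightarrow> w = 0" and nz: "A $ i \<noteq> 0"
  obtains B k where "B \<in> invertible_submatrices A" "B $ k = A $ i"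
proof -
  have rows: "rows A = range (($) A)"
    by (auto simp: rows_def row_def)
  have span: "vec.span (rows A) = UNIV"
    using ker by (simp add: matrix_left_invertible_span_rows_gen[symmetric] matrix_left_invertible_ker)
  have "{A $ i} \<subseteq> rows A" "vec.independent {A $ i}"
    using nz by (auto simp: rows)
  then obtain S where S: "{A $ i} \<subseteq> S" "S \<subseteq> rows A" "vec.independent S" "rows A \<subseteq> vec.span S"
    using vec.maximal_independent_subset_extend by metis
  have spanS: "vec.span S = UNIV"
    using S(4) span vec.span_minimal[OF _ vec.subspace_span] by blast
  have "finite S"
    using S(2) unfolding rows by (rule finite_subset) simp
  moreover have "card S = CARD('n)"
    using vec.basis_card_eq_dim[of S UNIV] S(3) spanS by (simp add: card_cart_basis)
  \<comment> \<open>The basis has as many elements as there are columns, so \<open>'n\<close> can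
    index it and its vectors form a square matrix.\<close>
  ultimately obtain g :: "'n \<Rightarrow> rat ^ 'n" where g: "bij_betw g UNIV S"
    using finite_same_card_bij[of "UNIV :: 'n set" S] by auto
  have "g k \<in> range (($) A)" for k
    using bij_betwE[OF g] S(2) by (auto simp: rows)
  then have "\<forall>k. \<exists>l. g k = A $ l"
    by (simp add: image_iff)
  then obtain f where f: "\<And>k. g k = A $ f k"
    by (metis choice)
  define B where "B = (\<chi> k. A $ f k)"
  have "inj f"
  proof (rule injI)
    fix k l
    assume "f k = f l"
    then have "g k = g l" by (simp add: f)
    with bij_betw_imp_inj_on[OF g] show "k = l" by (simp add: inj_eq)
  qed
  have "rows B = S"
    using bij_betw_imp_surj_on[OF g] by (auto simp: rows_def row_def B_def f[symmetric])
  \<comment> \<open>Spanning rows give a left inverse, which suffices for a square matrix.\<close>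
  then have "invertible B"
    using spanS by (simp add: invertible_left_inverse matrix_left_invertible_span_rows_gen)
  with \<open>inj f\<close> have "B \<in> invertible_submatrices A"
    by (auto simp: invertible_submatrices_def B_def)
  moreover obtain k where "g k = A $ i"
    using S(1) bij_betw_imp_surj_on[OF g] by (metis imageE insert_subset)
  then have "B $ k = A $ i"
    by (simp add: B_def f)
  ultimately show thesis by (rule that)
qed

theorem theorem3p2:
  fixes W :: "('n::finite, complex) mpoly"
    and A :: "rat ^ 'n ^ 'm::finite"
    and R :: "(rat ^ 'n ^ 'n) set"
  assumes "admissible W"
    and "is_exponent_matrix W A"
    and "is_representative_system R A"
  shows "max_symmetry_group A =
    (\<Inter>B\<in>R. group_closure (vec_mod_int ` columns (matrix_inv B)))"
proof -
  have int: "A $ i $ j \<in> \<int>" for i j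
    using assms(2) by (auto simp: is_exponent_matrix_def)
  have sub: "R \<subseteq> invertible_submatrices A"
    using assms(3) by (simp add: is_representative_system_def)
  have closure_iff: "vec_mod_int v \<in> group_closure (vec_mod_int ` columns (matrix_inv B)) \<longleftrightarrow>
      (\<forall>k. (B *v v) $ k \<in> \<int>)" if "B \<in> R" for B v
    using that sub int
    by (intro vec_mod_int_in_group_closure_columns_inv_iff) (auto simp: invertible_submatrices_def)
  have submatrix: "(\<forall>i. (A *v v) $ i \<in> \<int>) \<longleftrightarrow> (\<forall>B\<in>R. \<forall>k. (B *v v) $ k \<in> \<int>)" for v
  proof (intro iffI ballI allI)
    fix B k
    assume "\<forall>i. (A *v v) $ i \<in> \<int>" "B \<in> R"
    then show "(B *v v) $ k \<in> \<int>"
      using sub by (auto simp: invertible_submatrices_def matrix_vector_mult_def)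
  next
    fix i
    assume R: "\<forall>B\<in>R. \<forall>k. (B *v v) $ k \<in> \<int>"
    show "(A *v v) $ i \<in> \<int>"
    proof (cases "A $ i = 0")
      \<comment> \<open>A zero row lies in no invertible submatrix, but it imposes no condition
        either.\<close>
      case True
      then show ?thesis by (simp add: matrix_vector_mult_def)
    next
      case False
      have "w = 0" if "A *v w = 0" for w
        using unique_weights_imp_kernel_trivial[OF _ assms(2) that] assms(1)
        by (simp add: admissible_def)
      then obtain B k where B: "B \<in> invertible_submatrices A" "B $ k = A $ i"
        using nonzero_row_in_invertible_submatrix[OF _ False] by metis
      \<comment> \<open>\<open>R\<close> need not contain \<open>B\<close> itself; the row
        \<open>A $ i\<close> reappears in the representative \<open>C\<close> at a permuted position
        \<open>l\<close>.\<close>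
      then obtain C where "C \<in> R" "row_equivalent B C"
        using assms(3) unfolding is_representative_system_def by blast
      then obtain p where p: "bij p" "C = (\<chi> l. B $ p l)"
        by (auto simp: row_equivalent_def)
      then obtain l where "p l = k"
        by (metis bij_pointE)
      with p B have "C $ l = A $ i" by simp
      then have "(A *v v) $ i = (C *v v) $ l"
        by (simp add: matrix_vector_mult_def)
      with R \<open>C \<in> R\<close> show ?thesis by simp
    qed
  qed
  show ?thesis
  proof (rule set_eqI)
    fix g :: "rat_mod_int ^ 'n"
    \<comment> \<open>For a fixed representative \<open>v\<close>, membership on either side is an
      integrality condition on \<open>v\<close>.\<close>
    obtain v where "g = vec_mod_int v"
      using surj_vec_mod_int by (metis surjD)
    then show "g \<in> max_symmetry_group A \<longleftrightarrow>
        g \<in> (\<Inter>B\<in>R. group_closure (vec_mod_int ` columns (matrix_inv B)))"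
      using vec_mod_int_in_max_symmetry_group_iff[OF assms(2), of v] submatrix[of v] closure_iff[of _ v]
      by simp
  qed
qed

end
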